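(* Let $S$ be a finite multiset of $d$-dimensional figures. Let $f_S(n)$ be the number of ways to place all of the figures in $S$ on $T^d_n$ such that none overlap (for a finite set of small values of $n$, there may be figures that are impossible to place on $T^d_n$; in this case, let $f_S(n)=0$). Then there exist a positive integer $n_0$ and an integer polynomial $p(x)$ such that $f_S(n)=p(n^d)$ for all $n\ge n_0$.
   Context: $T^d_\infty$ is the infinite grid graph with vertex set $\mathbb{Z}^d$, in which two vertices are adjacent iff they differ by $\pm$ a standard basis vector. $T^d_n=(C_n)^d$ is the $d$-dimensional toroidal grid graph of size $n$, the product of $d$ copies of the cycle $C_n$, with vertex set $(\mathbb{Z}/n\mathbb{Z})^d$. A $d$-dimensional figure is a finite subset of the vertices of $T^d_\infty$, up to translation by integer vectors. The girth of a figure is the maximum coordinate difference between two of its vertices. When $n$ is larger than the girth, the figure can be viewed as a subset of $T^d_n$ up to translation; a placement of it on $T^d_n$ is the image in $(\mathbb{Z}/n\mathbb{Z})^d$ of a subset of $\mathbb{Z}^d$ representing the figure. Two placed figures overlap if they share a vertex. Repeated copies of the same figure in the multiset $S$ are indistinguishable.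
   Formalization: "Integer polynomial" is taken to mean a rational polynomial with integer values at all integers; integer coefficients are impossible in general, since two indistinguishable single vertices give p(x) = x(x-1)/2. *)

theory Defs
  imports
    "HOL-Analysis.Finite_Cartesian_Product"
    "HOL-Library.Multiset"
    "HOL-Computational_Algebra.Polynomial"
begin

text \<open>
  The dimension is \<open>d = CARD('d)\<close>, and the vertices of the infinite grid are the elements of
  \<^typ>\<open>int ^ 'd\<close>. Only the vertex sets of the grid graphs matter here, not their edges.
\<close>

definition translation_rel :: "((int ^ 'd) set \<times> (int ^ 'd) set) set" where
  "translation_rel = {(A, B). finite A \<and> finite B \<and> (\<exists>v. B = (\<lambda>x. v + x) ` A)}"

text \<open>A figure is a whole translation class; its members are the sets that represent it.\<close>

definition figures :: "(int ^ 'd) set set set" where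
  "figures = {A. finite A} // translation_rel"

text \<open>
  Inserting \<open>0\<close> only matters for the empty set, whose girth is thereby \<open>0\<close>.
\<close>

definition girth :: "(int ^ 'd) set \<Rightarrow> int" where
  "girth A = Max (insert 0 {\<bar>x $ i - y $ i\<bar> | x y i. x \<in> A \<and> y \<in> A})"

text \<open>
  Vertices of the torus are represented by their canonical residues: the quotient map from
  \<open>\<int>\<^sup>d\<close> to \<open>(\<int>/n\<int>)\<^sup>d\<close> reduces every coordinate modulo \<open>n\<close>.
\<close>

definition torus_proj :: "nat \<Rightarrow> int ^ 'd \<Rightarrow> int ^ 'd" where
  "torus_proj n x = (\<chi> i. x $ i mod int n)"

text \<open>
  The girth is translation invariant, so the side condition holds for all representatives of
  a figure or for none; in the latter case the figure cannot be placed.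
\<close>

definition placements :: "nat \<Rightarrow> (int ^ 'd) set set \<Rightarrow> (int ^ 'd) set set" where
  "placements n F = {torus_proj n ` A | A. A \<in> F \<and> girth A < int n}"

text \<open>
  A way to place \<open>S\<close> is a multiset of pairs (figure, placement of that figure) whose figures
  make up \<open>S\<close>. Being a multiset, it does not distinguish repeated copies of the same figure.
\<close>

definition ways_to_place ::
    "(int ^ 'd) set set multiset \<Rightarrow> nat \<Rightarrow> ((int ^ 'd) set set \<times> (int ^ 'd) set) multiset set" where
  "ways_to_place S n =
     {W. image_mset fst W = S \<and>
         (\<forall>(F, P) \<in># W. P \<in> placements n F) \<and>
         (\<forall>X \<in># W. \<forall>Y \<in># W - {#X#}. snd X \<inter> snd Y = {})}"

definition num_placings :: "(int ^ 'd) set set multiset \<Rightarrow> nat \<Rightarrow> nat" where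
  "num_placings S n = card (ways_to_place S n)"

text \<open>
  ``Integer polynomial'' means integer-valued: since copies are indistinguishable, two single
  vertices give \<open>p(x) = x (x - 1) / 2\<close>, so the coefficients need not be integers.
\<close>

definition integer_valued_poly :: "rat poly \<Rightarrow> bool" where
  "integer_valued_poly p \<longleftrightarrow> (\<forall>k :: int. poly p (of_int k) \<in> \<int>)"

end

theory Submission
  imports Defs "HOL-Combinatorics.Multiset_Permutations" "HOL-Library.FuncSet"
begin

text \<open>
  The torus \<open>(\<int>/n\<int>)\<^sup>d\<close> is a finite set on which \<open>\<int>\<^sup>d\<close> acts by translation, and for large \<open>n\<close>
  no short nonzero vector fixes a point. The count turns out to depend only on these two
  properties and on the number of points, so it is carried out for every such action.

  Put the figures in a list and choose representatives \<open>A\<^sub>1, \<dots>, A\<^sub>s\<close>. A copy of \<open>A\<^sub>i\<close> is given by its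
  base point \<open>x\<^sub>i\<close>, and the copies of \<open>A\<^sub>i\<close> and \<open>A\<^sub>j\<close> are disjoint iff \<open>x\<^sub>j \<noteq> g x\<^sub>i\<close> for all
  \<open>g \<in> A\<^sub>i - A\<^sub>j\<close>. So ordered packings are colourings of a finite graph whose edges carry group
  elements (a gain graph). As for the chromatic polynomial, deleting and contracting an edge
  shows that their number is \<open>q(N)\<close>, where \<open>q\<close> has integer coefficients and \<open>N\<close> is the number of
  points (\<open>card_colourings_polynomial\<close>). A loop that arises by contraction is unsatisfiable if its
  group element is \<open>0\<close>, and void if it is nonzero, because the action is locally free.

  Nonempty figures in a packing have pairwise different copies, so a packing of \<open>s\<close> figures has
  \<open>s!\<close> orderings, up to a constant factor that comes from repetitions of the empty figure.
  Hence \<open>s! f = q(N)\<close> for the number \<open>f\<close> of packings and another integer polynomial \<open>q\<close>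
  (\<open>card_packings\<close>), and \<open>p = q / s!\<close> is the polynomial sought.

  It remains to see that \<open>s!\<close> divides \<open>q(k)\<close> for every integer \<open>k\<close>. Knowing this at \<open>k = n\<^sup>d\<close> does
  not suffice, already for \<open>d = 2\<close>: \<open>n\<^sup>2 (n\<^sup>2 - 1) / 12\<close> is always an integer, but \<open>x (x - 1) / 12\<close> is not
  integer-valued. But the same \<open>q\<close> counts packings on every torus with large and possibly different
  side lengths. The number of points of such a torus can be chosen congruent to \<open>k\<close> modulo \<open>s!\<close>
  (\<open>ex_torus_volume_cong\<close>), and the values of an integer polynomial at congruent arguments are
  congruent.
\<close>

section \<open>Locally free actions and gain-graph colourings\<close>

locale finite_action =
  fixes X :: "'x set" and act :: "'g::ab_group_add \<Rightarrow> 'x \<Rightarrow> 'x"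
  assumes finite_X: "finite X"
    and nonempty_X: "X \<noteq> {}"
    and act_closed: "x \<in> X \<Longrightarrow> act g x \<in> X"
    and act_zero: "x \<in> X \<Longrightarrow> act 0 x = x"
    and act_add: "x \<in> X \<Longrightarrow> act (g + h) x = act g (act h x)"
begin

lemma act_eq_act_iff:
  assumes "x \<in> X" "y \<in> X"
  shows "act a x = act b y \<longleftrightarrow> y = act (a - b) x"
proof
  assume "act a x = act b y"
  then have "act (- b) (act a x) = act (- b) (act b y)"
    by simp
  then show "y = act (a - b) x"
    using assms by (simp flip: act_add add: act_zero)
next
  assume "y = act (a - b) x"
  then show "act a x = act b y"
    using assms by (simp flip: act_add)
qed

end

text \<open>
  Freeness is required only for the group elements in \<open>R\<close>: an action on a finite set of an infinite
  group is never free, but each of the arguments below meets only finitely many group elements.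
\<close>

definition locally_free :: "'g::ab_group_add set \<Rightarrow> 'x set \<Rightarrow> ('g \<Rightarrow> 'x \<Rightarrow> 'x) \<Rightarrow> bool" where
  "locally_free R X act \<longleftrightarrow> (\<forall>g\<in>R. \<forall>x\<in>X. act g x = x \<longrightarrow> g = 0)"

lemma locally_free_Un:
  "locally_free (R \<union> R') X act \<longleftrightarrow> locally_free R X act \<and> locally_free R' X act"
  by (auto simp: locally_free_def)

lemma locally_free_UN:
  "locally_free (\<Union>i\<in>I. R i) X act \<longleftrightarrow> (\<forall>i\<in>I. locally_free (R i) X act)"
  by (auto simp: locally_free_def)

text \<open>
  A triple \<open>(i, j, g)\<close> is an edge from \<open>i\<close> to \<open>j\<close> with gain \<open>g\<close>. Loops are allowed, since contraction
  produces them.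
\<close>

definition colourings ::
    "'x set \<Rightarrow> ('g \<Rightarrow> 'x \<Rightarrow> 'x) \<Rightarrow> 'i set \<Rightarrow> ('i \<times> 'i \<times> 'g) list \<Rightarrow> ('i \<Rightarrow> 'x) set" where
  "colourings X act I C =
     {v \<in> I \<rightarrow>\<^sub>E X. \<forall>(i, j, g) \<in> set C. v j \<noteq> act g (v i)}"

text \<open>
  Contracting the edge \<open>(i, j, g)\<close> substitutes \<open>g (v i)\<close> for \<open>v j\<close>. An edge that leaves \<open>j\<close> thereby
  gains \<open>g\<close>, and one that enters \<open>j\<close> loses it.
\<close>

definition contract ::
    "'i \<Rightarrow> 'i \<Rightarrow> 'g::ab_group_add \<Rightarrow> 'i \<times> 'i \<times> 'g \<Rightarrow> 'i \<times> 'i \<times> 'g" where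
  "contract i j g = (\<lambda>(k, l, h).
     (if k = j then i else k, if l = j then i else l,
      h + (if k = j then g else 0) - (if l = j then g else 0)))"

lemma finite_colourings: "finite I \<Longrightarrow> finite X \<Longrightarrow> finite (colourings X act I C)"
  unfolding colourings_def by (rule finite_subset[OF _ finite_PiE[of I "\<lambda>_. X"]]) auto

context finite_action
begin

lemma contract_satisfied_iff:
  assumes w: "\<And>k. k \<in> I - {j} \<Longrightarrow> w k \<in> X"
    and i: "i \<in> I - {j}" and kl: "k \<in> I" "l \<in> I"
    and v: "v = w(j := act g (w i))"
    and c: "contract i j g (k, l, h) = (k', l', h')"
  shows "v l = act h (v k) \<longleftrightarrow> w l' = act h' (w k')"
proof -
  have [simp]: "w i \<in> X" using w i by auto
  have eq: "act g x = act h y \<longleftrightarrow> x = act (h - g) y" if "x \<in> X" "y \<in> X" for x y g h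
    using act_eq_act_iff[OF that(2,1), of h g] by auto
  show ?thesis
  proof (cases "k = j"; cases "l = j")
    assume "k = j" "l = j"
    moreover have "act g (w i) = act h (act g (w i)) \<longleftrightarrow> w i = act h (w i)"
      using eq[of "w i" "w i" g "h + g"] by (simp add: act_add)
    ultimately show ?thesis using c v i by (auto simp: contract_def)
  next
    assume "k = j" "l \<noteq> j"
    moreover have "act (h + g) (w i) = act h (act g (w i))" by (simp add: act_add)
    ultimately show ?thesis using c v i by (auto simp: contract_def)
  next
    assume "k \<noteq> j" "l = j"
    then show ?thesis using c v i kl w[of k] eq[OF \<open>w i \<in> X\<close>, of "w k" g h]
      by (auto simp: contract_def)
  next
    assume "k \<noteq> j" "l \<noteq> j"
    then show ?thesis using c v by (auto simp: contract_def)
  qed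
qed

text \<open>
  A colouring in which the edge \<open>(i, j, g)\<close> is violated is determined by its restriction to
  \<open>I - {j}\<close>, which can be any colouring of the contracted graph.
\<close>

lemma card_colourings_contract:
  assumes ij: "i \<in> I" "j \<in> I" "i \<noteq> j"
    and C: "\<forall>(k, l, h) \<in> set C. k \<in> I \<and> l \<in> I"
  shows "card {v \<in> colourings X act I C. v j = act g (v i)} =
         card (colourings X act (I - {j}) (map (contract i j g) C))"
proof -
  define ext where "ext = (\<lambda>w. w(j := act g (w i)))"
  have sat: "(\<forall>(k, l, h) \<in> set C. ext w l \<noteq> act h (ext w k)) \<longleftrightarrow>
      (\<forall>(k, l, h) \<in> set (map (contract i j g) C). w l \<noteq> act h (w k))"
    if w: "w \<in> (I - {j}) \<rightarrow>\<^sub>E X" for w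
  proof -
    have "(case c of (k, l, h) \<Rightarrow> ext w l \<noteq> act h (ext w k)) \<longleftrightarrow>
          (case contract i j g c of (k, l, h) \<Rightarrow> w l \<noteq> act h (w k))" if "c \<in> set C" for c
    proof -
      obtain k l h where c: "c = (k, l, h)" by (cases c)
      obtain k' l' h' where c': "contract i j g (k, l, h) = (k', l', h')"
        by (cases "contract i j g (k, l, h)")
      have "ext w l = act h (ext w k) \<longleftrightarrow> w l' = act h' (w k')"
        by (rule contract_satisfied_iff[where I = I and w = w and g = g, OF _ _ _ _ _ c'])
          (use w ij C that c in \<open>auto simp: ext_def PiE_mem\<close>)
      then show ?thesis by (simp add: c c')
    qed
    then show ?thesis by simp
  qed
  have "{v \<in> colourings X act I C. v j = act g (v i)} =
        ext ` colourings X act (I - {j}) (map (contract i j g) C)"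
  proof (intro set_eqI iffI)
    fix v assume v: "v \<in> {v \<in> colourings X act I C. v j = act g (v i)}"
    define w where "w = v(j := undefined)"
    have w: "w \<in> (I - {j}) \<rightarrow>\<^sub>E X"
      using v by (auto simp: w_def colourings_def PiE_def extensional_def)
    have ext: "ext w = v" using v ij by (auto simp: ext_def w_def)
    have "w \<in> colourings X act (I - {j}) (map (contract i j g) C)"
      using sat[OF w] w v unfolding ext by (simp add: colourings_def)
    then show "v \<in> ext ` colourings X act (I - {j}) (map (contract i j g) C)"
      using ext by blast
  next
    fix v assume "v \<in> ext ` colourings X act (I - {j}) (map (contract i j g) C)"
    then obtain w where w: "w \<in> colourings X act (I - {j}) (map (contract i j g) C)"
      and v: "v = ext w" by blast
    from w have wE: "w \<in> (I - {j}) \<rightarrow>\<^sub>E X" by (simp add: colourings_def)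
    have "w i \<in> X" using wE ij by (auto simp: PiE_mem)
    then have "ext w \<in> I \<rightarrow>\<^sub>E X"
      using wE ij by (auto simp: ext_def PiE_def extensional_def act_closed)
    then show "v \<in> {v \<in> colourings X act I C. v j = act g (v i)}"
      using sat[OF wE] w ij unfolding v by (simp add: colourings_def) (simp add: ext_def)
  qed
  moreover have "inj_on ext (colourings X act (I - {j}) (map (contract i j g) C))"
  proof (rule inj_onI)
    fix w w' assume "w \<in> colourings X act (I - {j}) (map (contract i j g) C)"
      "w' \<in> colourings X act (I - {j}) (map (contract i j g) C)" and eq: "ext w = ext w'"
    then have "w j = undefined" "w' j = undefined"
      by (auto simp: colourings_def PiE_def extensional_def)
    then show "w = w'" using fun_cong[OF eq]
      by (intro HOL.ext) (metis ext_def fun_upd_other)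
  qed
  ultimately show ?thesis by (simp add: card_image)
qed

end

text \<open>
  Deletion and contraction, by induction on the number of edges. The set \<open>R\<close> collects the nonzero
  gains of the loops that occur on the way. It and the polynomial are chosen before the action,
  so that the same polynomial serves all actions.
\<close>

lemma card_colourings_polynomial:
  fixes C :: "('i \<times> 'i \<times> 'g::ab_group_add) list"
  assumes "finite I" and "\<forall>(i, j, g) \<in> set C. i \<in> I \<and> j \<in> I"
  shows "\<exists>R q. finite R \<and>
    (\<forall>(X :: 'x set) act. finite_action X act \<and> locally_free R X act \<longrightarrow>
       int (card (colourings X act I C)) = poly q (int (card X)))"
  using assms
proof (induction "length C" arbitrary: I C)
  case 0
  have "int (card (colourings X act I C)) = poly (monom 1 (card I)) (int (card X))"
    if "finite_action X act" for X :: "'x set" and act :: "'g \<Rightarrow> 'x \<Rightarrow> 'x"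
    using 0 by (simp add: colourings_def card_PiE poly_monom)
  then show ?case by (intro exI[of _ "{}"]) blast
next
  case (Suc n)
  then obtain i j g D where C: "C = (i, j, g) # D" and n: "n = length D"
    by (cases C) auto
  have ij: "i \<in> I" "j \<in> I" and D: "\<forall>(k, l, h) \<in> set D. k \<in> I \<and> l \<in> I"
    using Suc.prems C by auto
  obtain R q where R: "finite R" and
    q: "\<And>(X :: 'x set) act. finite_action X act \<Longrightarrow> locally_free R X act \<Longrightarrow>
       int (card (colourings X act I D)) = poly q (int (card X))"
    using Suc.hyps(1)[OF n Suc.prems(1) D] by blast
  show ?case
  proof (cases "i = j")
    case True
    show ?thesis
    proof (cases "g = 0")
      case True
      have "colourings X act I C = {}" if "finite_action X act"
        for X :: "'x set" and act :: "'g \<Rightarrow> 'x \<Rightarrow> 'x"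
        using finite_action.act_zero[OF that] ij True \<open>i = j\<close>
        by (fastforce simp: C colourings_def)
      then show ?thesis by (intro exI[of _ "{}"] exI[of _ 0]) simp
    next
      case False
      have "colourings X act I C = colourings X act I D" if "locally_free {g} X act"
        for X :: "'x set" and act :: "'g \<Rightarrow> 'x \<Rightarrow> 'x"
        using that ij False \<open>i = j\<close> by (force simp: C colourings_def locally_free_def)
      then show ?thesis using R q
        by (intro exI[of _ "R \<union> {g}"] exI[of _ q]) (simp add: locally_free_Un del: Un_insert_right)
    qed
  next
    case False
    have D': "\<forall>(k, l, h) \<in> set (map (contract i j g) D). k \<in> I - {j} \<and> l \<in> I - {j}"
      using D ij False by (auto simp: contract_def split: if_splits)
    obtain R' q' where R': "finite R'" and
      q': "\<And>(X :: 'x set) act. finite_action X act \<Longrightarrow> locally_free R' X act \<Longrightarrow>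
         int (card (colourings X act (I - {j}) (map (contract i j g) D))) = poly q' (int (card X))"
      using Suc.hyps(1)[OF _ _ D'] Suc.prems(1) n by auto
    have "int (card (colourings X act I C)) = poly (q - q') (int (card X))"
      if X: "finite_action X act" and free: "locally_free (R \<union> R') X act"
      for X :: "'x set" and act :: "'g \<Rightarrow> 'x \<Rightarrow> 'x"
    proof -
      interpret finite_action X act by fact
      have fin: "finite (colourings X act I D)"
        by (rule finite_colourings[OF Suc.prems(1) finite_X])
      have "colourings X act I C =
            colourings X act I D - {v \<in> colourings X act I D. v j = act g (v i)}"
        by (auto simp: C colourings_def)
      then have "int (card (colourings X act I C)) = int (card (colourings X act I D)) -
          int (card {v \<in> colourings X act I D. v j = act g (v i)})"
        using fin by (simp add: card_Diff_subset card_mono)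
      also have "\<dots> = poly (q - q') (int (card X))"
        using card_colourings_contract[OF ij False D] q[OF X] q'[OF X] free
        by (simp add: locally_free_Un)
      finally show ?thesis .
    qed
    then show ?thesis using R R' by (intro exI[of _ "R \<union> R'"] exI[of _ "q - q'"]) simp
  qed
qed

section \<open>Copies of a finite set\<close>

definition copy_at :: "('g \<Rightarrow> 'x \<Rightarrow> 'x) \<Rightarrow> 'g set \<Rightarrow> 'x \<Rightarrow> 'x set" where
  "copy_at act A x = (\<lambda>a. act a x) ` A"

definition copies :: "('g \<Rightarrow> 'x \<Rightarrow> 'x) \<Rightarrow> 'x set \<Rightarrow> 'g set \<Rightarrow> 'x set set" where
  "copies act X A = copy_at act A ` X"

lemma (in finite_action) copy_at_disjoint_iff:
  assumes "x \<in> X" "y \<in> X"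
  shows "copy_at act A x \<inter> copy_at act B y = {} \<longleftrightarrow> (\<forall>a\<in>A. \<forall>b\<in>B. y \<noteq> act (a - b) x)"
proof -
  have "copy_at act A x \<inter> copy_at act B y = {} \<longleftrightarrow> (\<forall>a\<in>A. \<forall>b\<in>B. act a x \<noteq> act b y)"
    by (auto simp: copy_at_def)
  then show ?thesis using act_eq_act_iff[OF assms] by simp
qed

text \<open>
  Translation by \<open>g\<close> adds \<open>\<bar>A\<bar> g\<close> to the sum of the elements of \<open>A\<close>.
\<close>

lemma translation_stabiliser_trivial:
  fixes A :: "(int ^ 'd) set"
  assumes "finite A" "A \<noteq> {}" "(\<lambda>a. a + g) ` A = A"
  shows "g = 0"
proof -
  have "(\<Sum>a\<in>A. a $ i) = (\<Sum>a\<in>(\<lambda>a. a + g) ` A. a $ i)" for i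
    using assms by simp
  also have "\<And>i. (\<Sum>a\<in>(\<lambda>a. a + g) ` A. a $ i) = (\<Sum>a\<in>A. a $ i) + int (card A) * g $ i"
    by (subst sum.reindex) (auto simp: sum.distrib)
  finally have "int (card A) * g $ i = 0" for i by simp
  then show ?thesis using assms by (simp add: vec_eq_iff)
qed

text \<open>
  If the copies at \<open>x\<close> and \<open>y\<close> coincide, then \<open>y = g x\<close> where \<open>g\<close> is a difference of two elements of
  \<open>A\<close>. Local freeness lifts the equality of the copies to \<open>A + g = A\<close>, whence \<open>g = 0\<close>.
  Nonemptiness matters: all copies of the empty set are equal.
\<close>

lemma inj_on_copy_at:
  fixes A :: "(int ^ 'd) set"
  assumes A: "finite A" "A \<noteq> {}"
  obtains R where "finite R"
    and "\<And>(X :: 'x set) act. finite_action X act \<Longrightarrow> locally_free R X act \<Longrightarrow>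
           inj_on (copy_at act A) X"
proof
  define R where "R = (\<lambda>(a, b, c, d). a + b - c - d) ` (A \<times> A \<times> A \<times> A)"
  show "finite R" using A by (simp add: R_def)
  fix X :: "'x set" and act
  assume X: "finite_action X act" and free: "locally_free R X act"
  interpret finite_action X act by fact
  show "inj_on (copy_at act A) X"
  proof (rule inj_onI)
    fix x y assume xy: "x \<in> X" "y \<in> X" and eq: "copy_at act A x = copy_at act A y"
    obtain b where b: "b \<in> A" using A by blast
    then have "act b y \<in> copy_at act A x" by (simp add: eq) (simp add: copy_at_def)
    then obtain c where c: "c \<in> A" "act c x = act b y" by (auto simp: copy_at_def)
    define g where "g = c - b"
    have y: "y = act g x" using c act_eq_act_iff[OF xy] by (simp add: g_def)
    have "(\<lambda>a. a + g) ` A \<subseteq> A"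
    proof
      fix z assume "z \<in> (\<lambda>a. a + g) ` A"
      then obtain a where a: "a \<in> A" "z = a + g" by blast
      have "act a y \<in> copy_at act A x" using a by (simp add: eq) (simp add: copy_at_def)
      then obtain d where d: "d \<in> A" "act d x = act a y" by (auto simp: copy_at_def)
      then have "act d x = act (a + g) x" using y xy by (simp add: act_add)
      then have "act (a + g - d) x = x" using act_eq_act_iff[OF xy(1,1), of "a + g" d] by simp
      moreover have "a + g - d \<in> R"
        unfolding R_def by (rule image_eqI[of _ _ "(a, c, b, d)"]) (use a b c d in \<open>auto simp: g_def\<close>)
      ultimately have "a + g - d = 0" using free xy by (auto simp: locally_free_def)
      then show "z \<in> A" using a d by simp
    qed
    moreover have "card ((\<lambda>a. a + g) ` A) = card A" by (simp add: card_image)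
    ultimately have "(\<lambda>a. a + g) ` A = A" using A by (simp add: card_subset_eq)
    then have "g = 0" by (rule translation_stabiliser_trivial[OF A])
    then show "x = y" using y xy by (simp add: act_zero)
  qed
qed

section \<open>Packings\<close>

text \<open>
  This is the notion of a way to place \<open>S\<close>, for an arbitrary assignment \<open>Pl\<close> of admissible placements
  to figures. The generality is needed for tori with unequal side lengths.
\<close>

definition packings ::
    "('f \<Rightarrow> 'x set set) \<Rightarrow> 'f multiset \<Rightarrow> ('f \<times> 'x set) multiset set" where
  "packings Pl S =
     {W. image_mset fst W = S \<and>
         (\<forall>(F, P) \<in># W. P \<in> Pl F) \<and>
         (\<forall>Y \<in># W. \<forall>Z \<in># W - {#Y#}. snd Y \<inter> snd Z = {})}"

lemma packings_cong:
  assumes "\<And>F. F \<in># S \<Longrightarrow> Pl F = Pl' F"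
  shows "packings Pl S = packings Pl' S"
  using assms unfolding packings_def by fastforce

lemma pairwise_mset_iff_sorted_wrt:
  assumes "\<And>x y. Q x y \<Longrightarrow> Q y x"
  shows "(\<forall>x \<in># mset xs. \<forall>y \<in># mset xs - {#x#}. Q x y) \<longleftrightarrow> sorted_wrt Q xs"
proof (induction xs)
  case (Cons a xs)
  have "(\<forall>x \<in># add_mset a W. \<forall>y \<in># add_mset a W - {#x#}. Q x y) \<longleftrightarrow>
        (\<forall>y \<in># W. Q a y) \<and> (\<forall>x \<in># W. \<forall>y \<in># W - {#x#}. Q x y)" for W
  proof -
    have "add_mset a W - {#x#} = add_mset a (W - {#x#})" if "x \<in># W" for x
      using that by simp
    then show ?thesis using assms by (auto simp del: diff_add_mset_swap)
  qed
  from this[of "mset xs"] show ?case using Cons by simp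
qed simp

definition ordered_packings ::
    "('f \<Rightarrow> 'x set set) \<Rightarrow> 'f list \<Rightarrow> ('f \<times> 'x set) list set" where
  "ordered_packings Pl Fs = {xs. map fst xs = Fs \<and> mset xs \<in> packings Pl (mset Fs)}"

lemma ordered_packings_iff:
  "xs \<in> ordered_packings Pl Fs \<longleftrightarrow> map fst xs = Fs \<and>
     (\<forall>i < length Fs. snd (xs ! i) \<in> Pl (Fs ! i)) \<and>
     (\<forall>i j. i < j \<longrightarrow> j < length Fs \<longrightarrow> snd (xs ! i) \<inter> snd (xs ! j) = {})"
proof -
  have "(\<forall>Y \<in># mset xs. \<forall>Z \<in># mset xs - {#Y#}. snd Y \<inter> snd Z = {}) \<longleftrightarrow>
        sorted_wrt (\<lambda>Y Z. snd Y \<inter> snd Z = {}) xs"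
    by (rule pairwise_mset_iff_sorted_wrt) auto
  moreover have "(\<forall>(F, P) \<in># mset xs. P \<in> Pl F) \<longleftrightarrow>
      (\<forall>i < length xs. snd (xs ! i) \<in> Pl (fst (xs ! i)))"
    by (simp add: all_set_conv_all_nth case_prod_beta)
  ultimately have packing: "mset xs \<in> packings Pl (mset (map fst xs)) \<longleftrightarrow>
      (\<forall>i < length xs. snd (xs ! i) \<in> Pl (fst (xs ! i))) \<and>
      (\<forall>i j. i < j \<longrightarrow> j < length xs \<longrightarrow> snd (xs ! i) \<inter> snd (xs ! j) = {})"
    unfolding packings_def sorted_wrt_iff_nth_less by simp
  show ?thesis
  proof (cases "map fst xs = Fs")
    case True
    then have Fs: "Fs = map fst xs" by simp
    show ?thesis unfolding Fs ordered_packings_def mem_Collect_eq packing by simp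
  qed (simp add: ordered_packings_def)
qed

text \<open>
  Recording base points identifies ordered packings with colourings. Only the positions \<open>I\<close> of
  nonempty sets become vertices of the gain graph: an empty set has a single copy, which overlaps
  nothing.
\<close>

lemma card_ordered_packings:
  fixes rep :: "'f \<Rightarrow> (int ^ 'd) set"
  assumes fin: "\<And>F. F \<in> set Fs \<Longrightarrow> finite (rep F)"
  shows "\<exists>R q. finite R \<and>
    (\<forall>(X :: 'x set) act. finite_action X act \<and> locally_free R X act \<longrightarrow>
       finite (ordered_packings (\<lambda>F. copies act X (rep F)) Fs) \<and>
       int (card (ordered_packings (\<lambda>F. copies act X (rep F)) Fs)) = poly q (int (card X)))"
proof -
  define A where "A i = rep (Fs ! i)" for i
  define I where "I = {i. i < length Fs \<and> A i \<noteq> {}}"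
  have finI: "finite I" by (simp add: I_def)
  have finA: "finite (A i)" if "i < length Fs" for i using fin that by (simp add: A_def)
  define Cs where
    "Cs = {(i, j, a - b) | i j a b. i \<in> I \<and> j \<in> I \<and> i < j \<and> a \<in> A i \<and> b \<in> A j}"
  have "Cs = (\<Union>i\<in>I. \<Union>j\<in>{j \<in> I. i < j}. \<Union>a\<in>A i. \<Union>b\<in>A j. {(i, j, a - b)})"
    unfolding Cs_def by blast
  then have "finite Cs" using finI finA by (auto simp: I_def)
  then obtain C where "set C = Cs" using finite_list by blast
  then have C: "set C = {(i, j, a - b) | i j a b. i \<in> I \<and> j \<in> I \<and> i < j \<and> a \<in> A i \<and> b \<in> A j}"
    by (simp add: Cs_def)
  have "\<forall>(i, j, g) \<in> set C. i \<in> I \<and> j \<in> I" by (auto simp: C)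
  from card_colourings_polynomial[OF finI this] obtain R q where R: "finite R" and
    q: "\<And>(X :: 'x set) act. finite_action X act \<Longrightarrow> locally_free R X act \<Longrightarrow>
       int (card (colourings X act I C)) = poly q (int (card X))"
    by blast
  have "\<forall>i\<in>I. \<exists>R. finite R \<and> (\<forall>(X :: 'x set) act. finite_action X act \<longrightarrow>
      locally_free R X act \<longrightarrow> inj_on (copy_at act (A i)) X)"
    by (metis (mono_tags, lifting) inj_on_copy_at finA I_def mem_Collect_eq)
  then obtain R' where R': "\<And>i. i \<in> I \<Longrightarrow> finite (R' i)" and
    inj: "\<And>i (X :: 'x set) act. i \<in> I \<Longrightarrow> finite_action X act \<Longrightarrow> locally_free (R' i) X act \<Longrightarrow>
      inj_on (copy_at act (A i)) X"
    by metis
  have "finite (ordered_packings (\<lambda>F. copies act X (rep F)) Fs) \<and>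
        int (card (ordered_packings (\<lambda>F. copies act X (rep F)) Fs)) = poly q (int (card X))"
    if X: "finite_action X act" and free: "locally_free (R \<union> (\<Union>i\<in>I. R' i)) X act"
    for X :: "'x set" and act
  proof -
    interpret finite_action X act by fact
    have injA: "inj_on (copy_at act (A i)) X" if "i \<in> I" for i
      using inj[OF that X] free that by (simp add: locally_free_Un locally_free_UN)
    \<comment> \<open>For \<open>i \<notin> I\<close> the value \<open>v i\<close> is a mere default, but the copy of the empty set does not depend on it.\<close>
    define place where
      "place v = map (\<lambda>i. (Fs ! i, copy_at act (A i) (v i))) [0..<length Fs]" for v
    have copy_empty: "copy_at act (A i) x = {}" if "i \<notin> I" "i < length Fs" for i x
      using that by (simp add: I_def copy_at_def)
    have disj: "(\<forall>(i, j, g) \<in> set C. v j \<noteq> act g (v i)) \<longleftrightarrow>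
        (\<forall>i j. i < j \<longrightarrow> j < length Fs \<longrightarrow> copy_at act (A i) (v i) \<inter> copy_at act (A j) (v j) = {})"
      if v: "v \<in> I \<rightarrow>\<^sub>E X" for v
    proof -
      have "(\<forall>(i, j, g) \<in> set C. v j \<noteq> act g (v i)) \<longleftrightarrow>
        (\<forall>i\<in>I. \<forall>j\<in>I. i < j \<longrightarrow> (\<forall>a\<in>A i. \<forall>b\<in>A j. v j \<noteq> act (a - b) (v i)))"
        unfolding C by blast
      also have "\<dots> \<longleftrightarrow> (\<forall>i\<in>I. \<forall>j\<in>I. i < j \<longrightarrow>
          copy_at act (A i) (v i) \<inter> copy_at act (A j) (v j) = {})"
        using copy_at_disjoint_iff[OF PiE_mem[OF v] PiE_mem[OF v]] by simp
      also have "\<dots> \<longleftrightarrow>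
        (\<forall>i j. i < j \<longrightarrow> j < length Fs \<longrightarrow> copy_at act (A i) (v i) \<inter> copy_at act (A j) (v j) = {})"
      proof (intro iffI allI impI)
        fix i j assume H: "\<forall>i\<in>I. \<forall>j\<in>I. i < j \<longrightarrow>
            copy_at act (A i) (v i) \<inter> copy_at act (A j) (v j) = {}"
          and "i < j" "j < length Fs"
        then show "copy_at act (A i) (v i) \<inter> copy_at act (A j) (v j) = {}"
          using copy_empty[of i] copy_empty[of j] by (cases "i \<in> I \<and> j \<in> I") auto
      qed (simp add: I_def)
      finally show ?thesis .
    qed
    have "place ` colourings X act I C = ordered_packings (\<lambda>F. copies act X (rep F)) Fs"
    proof (intro set_eqI iffI)
      fix xs assume "xs \<in> place ` colourings X act I C"
      then obtain v where v: "v \<in> colourings X act I C" and xs: "xs = place v" by blast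
      have vE: "v \<in> I \<rightarrow>\<^sub>E X" using v by (simp add: colourings_def)
      have "copy_at act (A i) (v i) \<in> copies act X (rep (Fs ! i))" if "i < length Fs" for i
      proof (cases "i \<in> I")
        case True
        then show ?thesis using vE by (auto simp: copies_def A_def PiE_mem)
      next
        case False
        then show ?thesis using copy_empty[OF False that] nonempty_X
          by (auto simp: copies_def A_def)
      qed
      moreover have "map fst xs = Fs" by (simp add: xs place_def comp_def map_nth)
      ultimately show "xs \<in> ordered_packings (\<lambda>F. copies act X (rep F)) Fs"
        using v disj[OF vE] by (simp add: ordered_packings_iff xs place_def colourings_def)
    next
      fix xs assume xs: "xs \<in> ordered_packings (\<lambda>F. copies act X (rep F)) Fs"
      then have fst: "map fst xs = Fs" by (simp add: ordered_packings_iff)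
      then have len: "length xs = length Fs" by auto
      have "\<forall>i. \<exists>x. i < length Fs \<longrightarrow> x \<in> X \<and> snd (xs ! i) = copy_at act (A i) x"
        using xs by (auto simp: ordered_packings_iff copies_def A_def)
      then obtain f where f: "\<And>i. i < length Fs \<Longrightarrow> f i \<in> X \<and> snd (xs ! i) = copy_at act (A i) (f i)"
        by metis
      define v where "v = restrict f I"
      have vE: "v \<in> I \<rightarrow>\<^sub>E X" using f by (auto simp: v_def I_def)
      have snd: "snd (xs ! i) = copy_at act (A i) (v i)" if "i < length Fs" for i
        using f[OF that] copy_empty[OF _ that] by (cases "i \<in> I") (auto simp: v_def)
      have "xs = place v"
      proof (rule nth_equalityI)
        fix i assume i: "i < length xs"
        have "fst (xs ! i) = Fs ! i" using i by (simp flip: fst)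
        then show "xs ! i = place v ! i"
          using snd[of i] i len by (simp add: place_def prod_eq_iff)
      qed (simp add: place_def len)
      moreover have "\<forall>i j. i < j \<longrightarrow> j < length Fs \<longrightarrow>
          copy_at act (A i) (v i) \<inter> copy_at act (A j) (v j) = {}"
        using xs snd by (simp add: ordered_packings_iff)
      then have "v \<in> colourings X act I C"
        using vE disj[OF vE] by (simp add: colourings_def)
      ultimately show "xs \<in> place ` colourings X act I C" by blast
    qed
    then have image: "ordered_packings (\<lambda>F. copies act X (rep F)) Fs = place ` colourings X act I C"
      by (rule sym)
    have "inj_on place (colourings X act I C)"
    proof (rule inj_onI)
      fix v w assume "v \<in> colourings X act I C" "w \<in> colourings X act I C"
        and eq: "place v = place w"
      then have vw: "v \<in> I \<rightarrow>\<^sub>E X" "w \<in> I \<rightarrow>\<^sub>E X" by (simp_all add: colourings_def)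
      show "v = w"
      proof (rule PiE_ext[OF vw])
        fix i assume i: "i \<in> I"
        then have same: "copy_at act (A i) (v i) = copy_at act (A i) (w i)"
          using eq by (simp add: place_def I_def)
        show "v i = w i"
          by (rule inj_onD[OF injA[OF i] same PiE_mem[OF vw(1) i] PiE_mem[OF vw(2) i]])
      qed
    qed
    from card_image[OF this] show ?thesis
      unfolding image
      using q[OF X] free finite_imageI[OF finite_colourings[OF finI finite_X], of place act C]
      by (simp add: locally_free_Un)
  qed
  moreover have "finite (R \<union> (\<Union>i\<in>I. R' i))" using R R' finI by auto
  ultimately show ?thesis by blast
qed

text \<open>
  Nonempty copies cannot be repeated, as they would overlap themselves. So the only repeated
  entries of a packing come from figures with empty representatives, and their multiplicities
  are those in \<open>S\<close>. In particular the number of orderings is the same for all packings.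
\<close>

lemma packing_orderings:
  fixes W :: "('f \<times> 'x set) multiset" and rep :: "'f \<Rightarrow> 'g set"
  assumes W: "W \<in> packings (\<lambda>F. copies act X (rep F)) S"
  shows "(\<Prod>F | F \<in># S \<and> rep F = {}. fact (count S F)) * card (permutations_of_multiset W) =
         (fact (size S) :: nat)"
proof -
  have S: "S = image_mset fst W" using W by (simp add: packings_def)
  let ?E = "{Y \<in> set_mset W. rep (fst Y) = {}}"
  have snd_empty: "snd Y = {} \<longleftrightarrow> rep (fst Y) = {}" if "Y \<in># W" for Y
    using W that by (cases Y) (auto simp: packings_def copies_def copy_at_def)
  have one: "count W Y = 1" if Y: "Y \<in># W" "rep (fst Y) \<noteq> {}" for Y
  proof (rule ccontr)
    assume "count W Y \<noteq> 1"
    moreover have "count W Y > 0" using Y by (simp only: count_greater_zero_iff)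
    ultimately have "Y \<in># W - {#Y#}"
      by (simp add: in_diff_count del: count_greater_zero_iff)
    then have "snd Y \<inter> snd Y = {}" using W Y unfolding packings_def by blast
    then show False using snd_empty Y by auto
  qed
  have inj: "inj_on fst ?E"
  proof (rule inj_onI)
    fix Y Z assume YZ: "Y \<in> ?E" "Z \<in> ?E" "fst Y = fst Z"
    then have "snd Y = {}" "snd Z = {}" using snd_empty by auto
    then show "Y = Z" using YZ by (simp add: prod_eq_iff)
  qed
  have count: "count S (fst Y) = count W Y" if Y: "Y \<in> ?E" for Y
  proof -
    have "fst -` {fst Y} \<inter> set_mset W = {Y}"
      using Y inj by (auto dest: inj_onD)
    then show ?thesis by (simp add: S count_image_mset)
  qed
  have "(\<Prod>Y\<in>set_mset W. fact (count W Y)) = (\<Prod>Y\<in>?E. fact (count W Y) :: nat)"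
    by (rule prod.mono_neutral_right) (auto simp: one)
  also have "\<dots> = (\<Prod>F\<in>fst ` ?E. fact (count S F))"
    using inj count by (simp add: prod.reindex)
  also have "fst ` ?E = {F. F \<in># S \<and> rep F = {}}" by (auto simp: S image_iff)
  finally show ?thesis
    using card_permutations_of_multiset_aux[of W] by (simp add: S mult.commute)
qed

text \<open>
  Counts the lists whose multiset is a packing in two ways: by their list of figures, and by the
  packing that they order.
\<close>

lemma card_packings:
  fixes rep :: "'f \<Rightarrow> (int ^ 'd) set"
  assumes fin: "\<And>F. F \<in># S \<Longrightarrow> finite (rep F)"
  shows "\<exists>R q. finite R \<and>
    (\<forall>(X :: 'x set) act. finite_action X act \<and> locally_free R X act \<longrightarrow>
       fact (size S) * int (card (packings (\<lambda>F. copies act X (rep F)) S)) =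
       poly q (int (card X)))"
proof -
  let ?perms = "permutations_of_multiset S"
  have "\<forall>Fs\<in>?perms. \<exists>R q. finite R \<and>
    (\<forall>(X :: 'x set) act. finite_action X act \<and> locally_free R X act \<longrightarrow>
       finite (ordered_packings (\<lambda>F. copies act X (rep F)) Fs) \<and>
       int (card (ordered_packings (\<lambda>F. copies act X (rep F)) Fs)) = poly q (int (card X)))"
  proof
    fix Fs assume "Fs \<in> ?perms"
    then have "set Fs = set_mset S" by (metis permutations_of_multisetD set_mset_mset)
    then show "\<exists>R q. finite R \<and>
    (\<forall>(X :: 'x set) act. finite_action X act \<and> locally_free R X act \<longrightarrow>
       finite (ordered_packings (\<lambda>F. copies act X (rep F)) Fs) \<and>
       int (card (ordered_packings (\<lambda>F. copies act X (rep F)) Fs)) = poly q (int (card X)))"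
      using fin by (intro card_ordered_packings) auto
  qed
  then obtain R q where R: "\<And>Fs. Fs \<in> ?perms \<Longrightarrow> finite (R Fs)"
    and q: "\<And>Fs (X :: 'x set) act. Fs \<in> ?perms \<Longrightarrow> finite_action X act \<Longrightarrow>
       locally_free (R Fs) X act \<Longrightarrow>
       finite (ordered_packings (\<lambda>F. copies act X (rep F)) Fs) \<and>
       int (card (ordered_packings (\<lambda>F. copies act X (rep F)) Fs)) = poly (q Fs) (int (card X))"
    by metis
  define K :: nat where "K = (\<Prod>F | F \<in># S \<and> rep F = {}. fact (count S F))"
  define Q where "Q = smult (int K) (\<Sum>Fs\<in>?perms. q Fs)"
  have "fact (size S) * int (card (packings (\<lambda>F. copies act X (rep F)) S)) = poly Q (int (card X))"
    if X: "finite_action X act" and free: "locally_free (\<Union>Fs\<in>?perms. R Fs) X act"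
    for X :: "'x set" and act
  proof -
    define Pl where "Pl = (\<lambda>F. copies act X (rep F))"
    have q': "finite (ordered_packings Pl Fs) \<and>
        int (card (ordered_packings Pl Fs)) = poly (q Fs) (int (card X))" if "Fs \<in> ?perms" for Fs
      using q[OF that X] free that by (simp add: locally_free_UN Pl_def)
    define L where "L = {xs. mset xs \<in> packings Pl S}"
    have L1: "L = (\<Union>Fs\<in>?perms. ordered_packings Pl Fs)"
      by (auto simp: L_def ordered_packings_def permutations_of_multiset_def packings_def)
    have L2: "L = (\<Union>W\<in>packings Pl S. permutations_of_multiset W)"
      by (auto simp: L_def permutations_of_multiset_def)
    have finL: "finite L" using q' by (simp add: L1)
    have "packings Pl S \<subseteq> mset ` L"
      unfolding L_def by (metis (mono_tags, lifting) ex_mset image_eqI mem_Collect_eq subsetI)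
    then have finP: "finite (packings Pl S)" using finL finite_subset by blast
    have cL1: "card L = (\<Sum>Fs\<in>?perms. card (ordered_packings Pl Fs))"
      unfolding L1 by (rule card_UN_disjoint) (use q' in \<open>auto simp: ordered_packings_def\<close>)
    have "card L = (\<Sum>W\<in>packings Pl S. card (permutations_of_multiset W))"
      unfolding L2
      by (rule card_UN_disjoint[OF finP]) (auto dest: permutations_of_multisetD)
    then have "K * card L = (\<Sum>W\<in>packings Pl S. K * card (permutations_of_multiset W))"
      by (simp add: sum_distrib_left)
    also have "\<dots> = (\<Sum>W\<in>packings Pl S. fact (size S))"
      by (rule sum.cong) (auto simp: K_def Pl_def packing_orderings)
    finally have "fact (size S) * card (packings Pl S) = K * card L" by simp
    then have "int (fact (size S) * card (packings Pl S)) = int (K * card L)" by simp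
    also have "\<dots> = int K * (\<Sum>Fs\<in>?perms. poly (q Fs) (int (card X)))"
      using q' by (simp add: cL1)
    finally show ?thesis by (simp add: Q_def poly_sum Pl_def)
  qed
  then show ?thesis using R by (intro exI[of _ "\<Union>Fs\<in>?perms. R Fs"] exI[of _ Q]) auto
qed

section \<open>Tori with arbitrary side lengths\<close>

definition torus :: "('d \<Rightarrow> nat) \<Rightarrow> (int ^ 'd) set" where
  "torus m = {x. \<forall>i. 0 \<le> x $ i \<and> x $ i < int (m i)}"

definition reduce :: "('d \<Rightarrow> nat) \<Rightarrow> int ^ 'd \<Rightarrow> int ^ 'd" where
  "reduce m x = (\<chi> i. x $ i mod int (m i))"

definition shift :: "('d \<Rightarrow> nat) \<Rightarrow> int ^ 'd \<Rightarrow> int ^ 'd \<Rightarrow> int ^ 'd" where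
  "shift m v x = reduce m (v + x)"


lemma card_torus:
  fixes m :: "'d::finite \<Rightarrow> nat"
  shows "finite (torus m)" "card (torus m) = (\<Prod>i\<in>UNIV. m i)"
proof -
  have eq: "torus m = vec_lambda ` PiE UNIV (\<lambda>i. {0..<int (m i)})"
  proof (intro set_eqI iffI)
    fix x assume "x \<in> torus m"
    then show "x \<in> vec_lambda ` PiE UNIV (\<lambda>i. {0..<int (m i)})"
      by (intro image_eqI[of _ _ "vec_nth x"]) (auto simp: torus_def)
  qed (auto simp: torus_def PiE_iff)
  have inj: "inj_on vec_lambda B" for B :: "('d \<Rightarrow> int) set"
    by (rule inj_onI) (metis vec_lambda_inverse UNIV_I)
  show "finite (torus m)" unfolding eq by (intro finite_imageI finite_PiE) auto
  show "card (torus m) = (\<Prod>i\<in>UNIV. m i)"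
    unfolding eq by (simp add: card_image[OF inj] card_PiE)
qed

lemma finite_action_shift:
  assumes "\<And>i. m i > 0"
  shows "finite_action (torus m) (shift m)"
proof
  have "0 \<in> torus m" using assms by (simp add: torus_def)
  then show "torus m \<noteq> {}" by blast
  show "finite (torus m)" by (rule card_torus)
qed (use assms in \<open>auto simp: torus_def shift_def reduce_def vec_eq_iff
       mod_add_right_eq algebra_simps\<close>)

text \<open>
  A translation that fixes a point of the torus has coordinates divisible by the side lengths,
  so a nonzero one has a coordinate whose absolute value is at least some side length.
\<close>

lemma locally_free_shift:
  fixes R :: "(int ^ 'd) set"
  assumes "finite R"
  shows "\<exists>B. \<forall>m. (\<forall>i. B \<le> m i) \<longrightarrow> locally_free R (torus m) (shift m)"
proof -
  define B where "B = nat (Max (insert 0 {\<bar>g $ i\<bar> | g i. g \<in> R})) + 1"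
  have "{\<bar>g $ i\<bar> | g i. g \<in> R} = (\<lambda>(g, i). \<bar>g $ i\<bar>) ` (R \<times> UNIV)" by auto
  then have fin: "finite {\<bar>g $ i\<bar> | g i. g \<in> R}" using assms by simp
  have B: "\<bar>g $ i\<bar> < int B" if "g \<in> R" for g i
  proof -
    have "\<bar>g $ i\<bar> \<le> Max (insert 0 {\<bar>g $ i\<bar> | g i. g \<in> R})"
      using that fin by (intro Max_ge) auto
    then show ?thesis unfolding B_def by linarith
  qed
  have "g = 0" if m: "\<forall>i. B \<le> m i" and g: "g \<in> R" and x: "x \<in> torus m"
    and eq: "shift m g x = x" for m g x
  proof -
    have "g $ i = 0" for i
    proof -
      have "(g $ i + x $ i) mod int (m i) = x $ i mod int (m i)"
        using eq x by (auto simp: shift_def reduce_def vec_eq_iff torus_def)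
      then have "int (m i) dvd g $ i" by (simp add: mod_eq_dvd_iff)
      moreover have "\<bar>g $ i\<bar> < int (m i)" using B[OF g, of i] m by (meson le_less_trans less_le_trans of_nat_mono)
      ultimately show ?thesis using zdvd_not_zless[of "\<bar>g $ i\<bar>" "int (m i)"] by force
    qed
    then show ?thesis by (simp add: vec_eq_iff)
  qed
  then show ?thesis unfolding locally_free_def by blast
qed

section \<open>Figures on tori\<close>

lemma girth_translate: "girth ((\<lambda>x. v + x) ` A) = girth A"
proof -
  have "{\<bar>x $ i - y $ i\<bar> | x y i. x \<in> B \<and> y \<in> B} =
        {z. \<exists>x\<in>B. \<exists>y\<in>B. \<exists>i. z = \<bar>x $ i - y $ i\<bar>}" for B :: "(int ^ 'a) set"
    by blast
  then show ?thesis by (simp add: girth_def)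
qed

lemma figure_eq_translates:
  assumes "F \<in> figures"
  shows "\<exists>A. finite A \<and> F = {(\<lambda>x. v + x) ` A | v. True}"
proof -
  obtain A where "finite A" "F = translation_rel `` {A}"
    using assms by (auto simp: figures_def quotient_def)
  then show ?thesis by (intro exI[of _ A]) (auto simp: translation_rel_def)
qed

text \<open>
  Reduction modulo \<open>n\<close> maps the translate \<open>v + A\<close> to the copy of \<open>A\<close> at the residue of \<open>v\<close>.
\<close>

lemma placements_eq_copies:
  fixes A :: "(int ^ 'd) set"
  assumes F: "F = {(\<lambda>x. v + x) ` A | v. True}" and n: "girth A < int n" "n > 0"
  shows "placements n F = copies (shift (\<lambda>_. n)) (torus (\<lambda>_. n)) A"
proof -
  have proj: "torus_proj n ` (\<lambda>x. v + x) ` A = copy_at (shift (\<lambda>_. n)) A (torus_proj n v)" for v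
    by (simp add: copy_at_def image_image shift_def reduce_def torus_proj_def vec_eq_iff
        mod_simps add.commute)
  have torus: "torus (\<lambda>_. n) = range (torus_proj n :: int ^ 'd \<Rightarrow> _)"
  proof (intro set_eqI iffI)
    fix x :: "int ^ 'd" assume "x \<in> torus (\<lambda>_. n)"
    then have "x = torus_proj n x" by (simp add: torus_def torus_proj_def vec_eq_iff)
    then show "x \<in> range (torus_proj n)" by blast
  qed (use n in \<open>auto simp: torus_def torus_proj_def\<close>)
  have "girth B < int n" if "B \<in> F" for B
    using that n by (auto simp: F girth_translate)
  then have "placements n F = {torus_proj n ` B | B. B \<in> F}"
    unfolding placements_def by blast
  also have "\<dots> = {torus_proj n ` (\<lambda>x. v + x) ` A | v. True}"
    unfolding F by blast
  finally have "placements n F = {torus_proj n ` (\<lambda>x. v + x) ` A | v. True}" .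
  then show ?thesis by (auto simp: proj copies_def torus)
qed

section \<open>Integrality\<close>

lemma dvd_poly_diff:
  fixes q :: "int poly"
  shows "a - b dvd poly q a - poly q b"
proof (induction q)
  case (pCons c q)
  have "poly (pCons c q) a - poly (pCons c q) b = (a - b) * poly q a + b * (poly q a - poly q b)"
    by (simp add: algebra_simps)
  then show ?case using pCons by simp
qed simp

text \<open>
  All sides but one are taken congruent to \<open>1\<close> modulo \<open>M\<close>, and the remaining one congruent to \<open>k\<close>.
\<close>

lemma ex_torus_volume_cong:
  fixes M k :: int
  assumes "M > 0"
  shows "\<exists>m :: 'd::finite \<Rightarrow> nat. (\<forall>i. B \<le> m i \<and> 0 < m i) \<and> M dvd int (\<Prod>i\<in>UNIV. m i) - k"
proof -
  fix i0 :: 'd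
  define c where "c = \<bar>k\<bar> + int B + 1"
  define a where "a = nat (k + M * c)"
  define b where "b = nat (1 + M * int B)"
  define m where "m = (\<lambda>i. if i = i0 then a else b)"
  have "c \<le> M * c"
    using assms mult_right_mono[of 1 M c] by (simp add: c_def)
  then have "int B < k + M * c" unfolding c_def by linarith
  then have a: "int a = k + M * c" and "B < a" by (auto simp: a_def)
  have "int B \<le> M * int B"
    using assms mult_right_mono[of 1 M "int B"] by simp
  then have b: "int b = 1 + M * int B" and "B < b" by (auto simp: b_def)
  have "int (\<Prod>i\<in>UNIV. m i) = int a * int b ^ card (UNIV - {i0})"
    by (simp add: m_def prod.remove[of UNIV i0])
  moreover have "M dvd int b ^ e - 1" for e
  proof -
    have "int b - 1 dvd int b ^ e - 1"
      using dvd_poly_diff[of "int b" 1 "monom 1 e"] by (simp add: poly_monom)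
    moreover have "M dvd int b - 1" by (simp add: b)
    ultimately show ?thesis by (rule dvd_trans[rotated])
  qed
  ultimately have "M dvd int (\<Prod>i\<in>UNIV. m i) - k"
    using dvd_add[OF dvd_mult[of M "int b ^ card (UNIV - {i0}) - 1" "int a"],
        of "int a - k"] a by (simp add: algebra_simps)
  then show ?thesis using \<open>B < a\<close> \<open>B < b\<close> by (intro exI[of _ m]) (auto simp: m_def)
qed

theorem theorem3p1:
  fixes S :: "(int ^ 'd) set set multiset"
  assumes "set_mset S \<subseteq> figures"
  shows "\<exists>n0 > 0. \<exists>p :: rat poly. integer_valued_poly p \<and>
           (\<forall>n \<ge> n0. of_nat (num_placings S n) = poly p (of_nat (n ^ CARD('d))))"
proof -
  have "\<forall>F\<in>set_mset S. \<exists>A. finite A \<and> F = {(\<lambda>x. v + x) ` A | v. True}"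
    by (intro ballI figure_eq_translates subsetD[OF assms])
  from bchoice[OF this] obtain rep where
    rep_spec: "\<forall>F\<in>set_mset S. finite (rep F) \<and> F = {(\<lambda>x. v + x) ` rep F | v. True}" ..
  have fin: "finite (rep F)" if "F \<in># S" for F
    using bspec[OF rep_spec that] by (rule conjunct1)
  have rep: "F = {(\<lambda>x. v + x) ` rep F | v. True}" if "F \<in># S" for F
    using bspec[OF rep_spec that] by (rule conjunct2)
  obtain R :: "(int ^ 'd) set" and q where R: "finite R" and
    q: "\<And>(X :: (int ^ 'd) set) act. finite_action X act \<Longrightarrow> locally_free R X act \<Longrightarrow>
       fact (size S) * int (card (packings (\<lambda>F. copies act X (rep F)) S)) = poly q (int (card X))"
    using card_packings[of S rep, OF fin] by blast
  obtain B where B: "\<And>m. \<forall>i. B \<le> m i \<Longrightarrow> locally_free R (torus m) (shift m)"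
    using locally_free_shift[OF R] by blast
  define M :: int where "M = fact (size S)"
  have M: "M > 0" by (simp add: M_def)
  have count: "M * int (card (packings (\<lambda>F. copies (shift m) (torus m) (rep F)) S)) =
      poly q (int (\<Prod>i\<in>UNIV. m i))" if "\<forall>i. B \<le> m i \<and> 0 < m i" for m :: "'d \<Rightarrow> nat"
    using q[OF finite_action_shift B, of m] that by (simp add: M_def card_torus)
  define p where "p = smult (1 / of_int M) (map_poly of_int q :: rat poly)"
  have "poly (map_poly of_int q) (of_int x :: rat) = of_int (poly q x)" for x
    by (induction q) (simp_all add: map_poly_pCons)
  then have p: "poly p (of_int x) = of_int (poly q x) / of_int M" for x
    by (simp add: p_def)
  have "integer_valued_poly p"
    unfolding integer_valued_poly_def
  proof
    fix k :: int
    obtain m :: "'d \<Rightarrow> nat" where m: "\<forall>i. B \<le> m i \<and> 0 < m i"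
      and dvd: "M dvd int (\<Prod>i\<in>UNIV. m i) - k"
      using ex_torus_volume_cong[OF M] by blast
    have "M dvd poly q (int (\<Prod>i\<in>UNIV. m i))" using count[OF m] by (metis dvd_triv_left)
    moreover have "M dvd poly q (int (\<Prod>i\<in>UNIV. m i)) - poly q k"
      using dvd dvd_poly_diff by (rule dvd_trans)
    ultimately have "M dvd poly q k" by (simp add: dvd_diff_right_iff)
    then show "poly p (of_int k) \<in> \<int>" using M by (auto simp: p)
  qed
  moreover define n0 where "n0 = B + 1 + (\<Sum>F\<in>set_mset S. nat (girth (rep F)))"
  have "of_nat (num_placings S n) = poly p (of_nat (n ^ CARD('d)))" if n: "n \<ge> n0" for n
  proof -
    have girth: "girth (rep F) < int n" if "F \<in># S" for F
    proof -
      have "nat (girth (rep F)) \<le> (\<Sum>F\<in>set_mset S. nat (girth (rep F)))"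
        using that by (intro member_le_sum) auto
      then show ?thesis using n by (simp add: n0_def)
    qed
    have "n > 0" using n by (simp add: n0_def)
    then have "packings (placements n) S =
        packings (\<lambda>F. copies (shift (\<lambda>_. n)) (torus (\<lambda>_. n)) (rep F)) S"
      by (intro packings_cong placements_eq_copies rep girth)
    then have "num_placings S n =
        card (packings (\<lambda>F. copies (shift (\<lambda>_. n)) (torus (\<lambda>_. n)) (rep F)) S)"
      by (simp add: num_placings_def ways_to_place_def packings_def)
    then have "M * int (num_placings S n) = poly q (int (n ^ CARD('d)))"
      using count[of "\<lambda>_. n"] n by (simp add: n0_def)
    then have "poly p (of_int (int (n ^ CARD('d)))) = of_int (M * int (num_placings S n)) / of_int M"
      unfolding p by simp
    then show ?thesis using M by simp
  qed
  moreover have "n0 > 0" by (simp add: n0_def)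
  ultimately show ?thesis by blast
qed

end
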